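(* The following two vertical composition rules of relational Hoare logic, VC-FC and VC-Refine, can be derived using the consequence rule and the rule ExIntro in standard Hoare logic. (VC-FC) From $\langle\mathbb{P}\wedge[c^H]\rangle\,c^L\,\langle\mathbb{Q}\wedge[\mathsf{skip}]\rangle$ and $\vdash_\forall\{P^H\}\,c^H\,\{Q^H\}$, infer $\vdash_\forall\{\mathbb{P}\odot P^H\}\,c^L\,\{\mathbb{Q}\odot Q^H\}$. (VC-Refine) From $\langle\mathbb{P}_1\wedge[c_2]\rangle\,c_1\,\langle\mathbb{Q}_1\wedge[\mathsf{skip}]\rangle$ and $\langle\mathbb{P}_2\wedge[c_3]\rangle\,c_2\,\langle\mathbb{Q}_2\wedge[\mathsf{skip}]\rangle$, infer $\langle\mathbb{P}_1\circ\mathbb{P}_2\wedge[c_3]\rangle\,c_1\,\langle\mathbb{Q}_1\circ\mathbb{Q}_2\wedge[\mathsf{skip}]\rangle$. Here, by the encoding of relational triples into standard triples, the two rules are transformed into the following rules about standard triples, and it is in this form that they are derived: (Enc-VC-FC) From $\forall X.\ \vdash_\forall\{\mathrm{enc}_X(\mathbb{P}\wedge[c^H])\}\,c^L\,\{\mathrm{enc}_X(\mathbb{Q}\wedge[\mathsf{skip}])\}$ and $\vdash_\forall\{P^H\}\,c^H\,\{Q^H\}$, infer $\vdash_\forall\{\mathbb{P}\odot P^H\}\,c^L\,\{\mathbb{Q}\odot Q^H\}$. (Enc-VC-Refine) From $\forall X_1.\ \vdash_\forall\{\mathrm{enc}_{X_1}(\mathbb{P}_1\wedge[c_2])\}\,c_1\,\{\mathrm{enc}_{X_1}(\mathbb{Q}_1\wedge[\mathsf{skip}])\}$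 and $\forall X_2.\ \vdash_\forall\{\mathrm{enc}_{X_2}(\mathbb{P}_2\wedge[c_3])\}\,c_2\,\{\mathrm{enc}_{X_2}(\mathbb{Q}_2\wedge[\mathsf{skip}])\}$, infer $\forall X.\ \vdash_\forall\{\mathrm{enc}_X(\mathbb{P}_1\circ\mathbb{P}_2\wedge[c_3])\}\,c_1\,\{\mathrm{enc}_X(\mathbb{Q}_1\circ\mathbb{Q}_2\wedge[\mathsf{skip}])\}$.
   Context: Programs and states. Each program $c$ over a state set $\Sigma$ has a denotational semantics $[\![c]\!]\subseteq\Sigma\times\Sigma$, where $(\sigma,\sigma')\in[\![c]\!]$ means that executing $c$ from $\sigma$ can terminate in $\sigma'$. The program $\mathsf{skip}$ has $[\![\mathsf{skip}]\!]=\{(\sigma,\sigma)\mid\sigma\in\Sigma\}$. $\Sigma^L,\Sigma^H$ are the sets of low-level and high-level states, and $\mathrm{Prog}^L,\mathrm{Prog}^H$ the sets of low-level and high-level programs. Assertions are sets, $s\models P$ means $s\in P$, and $P\Rightarrow P'$ means inclusion. Standard Hoare logic. $\vdash_\forall\{P\}\,c\,\{Q\}$ says that the standard triple is $\forall$-valid: for all $\sigma_1\models P$ and all $\sigma_2$ with $(\sigma_1,\sigma_2)\in[\![c]\!]$, $\sigma_2\models Q$. Consequence rule: from $P\Rightarrow P'$, $\vdash_\forall\{P'\}\,c\,\{Q'\}$ and $Q'\Rightarrow Q$, infer $\vdash_\forall\{P\}\,c\,\{Q\}$. ExIntro: if $\vdash_\forall\{P(a)\}\,c\,\{Q\}$ for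 every $a$, infer $\vdash_\forall\{\exists a.\,P(a)\}\,c\,\{Q\}$. Relational Hoare logic. Program-as-resource assertions are subsets of $\Sigma^L\times\Sigma^H\times\mathrm{Prog}^H$. A binary assertion $\mathbb{P}\subseteq\Sigma^L\times\Sigma^H$ is lifted by $(\sigma^L,\sigma^H,c)\models\mathbb{P}$ iff $(\sigma^L,\sigma^H)\models\mathbb{P}$; for a high-level program $c_0$, $(\sigma^L,\sigma^H,c)\models[c_0]$ iff $c=c_0$. Configuration refinement: $(\sigma_1,c_1)\hookrightarrow(\sigma_2,c_2)$ iff for every $\sigma_3$, $(\sigma_2,\sigma_3)\in[\![c_2]\!]$ implies $(\sigma_1,\sigma_3)\in[\![c_1]\!]$. The relational triple $\langle\mathcal{P}\rangle\,c^L\,\langle\mathcal{Q}\rangle$ is valid iff for all $(\sigma^L_1,\sigma^H_1,c^H_1)\models\mathcal{P}$ and all $\sigma^L_2$ with $(\sigma^L_1,\sigma^L_2)\in[\![c^L]\!]$ there exist $\sigma^H_2,c^H_2$ with $(\sigma^H_1,c^H_1)\hookrightarrow(\sigma^H_2,c^H_2)$ and $(\sigma^L_2,\sigma^H_2,c^H_2)\models\mathcal{Q}$. Encoding. $\sigma\models\mathrm{wlp}(c,X)$ iff for all $\sigma_0$, $(\sigma,\sigma_0)\in[\![c]\!]$ implies $\sigma_0\in X$. For $X\subseteq\Sigma^H$, $\mathrm{enc}_X(\mathcal{P})\subseteq\Sigma^L$ is defined by: $\sigma^L\models\mathrm{enc}_X(\mathcal{P})$ iff there exist $\sigma^H,c^H$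 with $(\sigma^L,\sigma^H,c^H)\models\mathcal{P}$ and $\sigma^H\models\mathrm{wlp}(c^H,X)$. It is known that $\langle\mathcal{P}\rangle\,c^L\,\langle\mathcal{Q}\rangle$ is valid if and only if $\vdash_\forall\{\mathrm{enc}_X(\mathcal{P})\}\,c^L\,\{\mathrm{enc}_X(\mathcal{Q})\}$ for every $X\subseteq\Sigma^H$. Objects in the rules. In VC-FC: $c^L\in\mathrm{Prog}^L$, $c^H\in\mathrm{Prog}^H$, $\mathbb{P},\mathbb{Q}\subseteq\Sigma^L\times\Sigma^H$, $P^H,Q^H\subseteq\Sigma^H$, $X$ ranges over subsets of $\Sigma^H$. In VC-Refine: $c_i$ is a program over a state set $\Sigma_i$ ($i=1,2,3$), $\mathbb{P}_1,\mathbb{Q}_1\subseteq\Sigma_1\times\Sigma_2$, $\mathbb{P}_2,\mathbb{Q}_2\subseteq\Sigma_2\times\Sigma_3$, $X_1\subseteq\Sigma_2$, $X_2,X\subseteq\Sigma_3$, and the relational notions are taken with low/high levels $(1,2)$, $(2,3)$ and $(1,3)$ respectively. Assertion linking: $\sigma^L\models\mathbb{P}\odot P^H$ iff there is $\sigma^H$ with $(\sigma^L,\sigma^H)\models\mathbb{P}$ and $\sigma^H\models P^H$; $(\sigma_1,\sigma_3)\models\mathbb{P}_1\circ\mathbb{P}_2$ iff there is $\sigma_2$ with $(\sigma_1,\sigma_2)\models\mathbb{P}_1$ and $(\sigma_2,\sigma_3)\models\mathbb{P}_2$. *)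

theory Defs
  imports Main
begin

text \<open>
  A state set is a type of states. Programs are elements of an arbitrary type with a
  denotation function, rather than being identified with their denotations, because the
  assertion \<open>[c]\<close> compares programs themselves.
\<close>

type_synonym ('p, 's) semantics = "'p \<Rightarrow> ('s \<times> 's) set"

definition hoare_valid :: "('p, 's) semantics \<Rightarrow> 's set \<Rightarrow> 'p \<Rightarrow> 's set \<Rightarrow> bool" where
  "hoare_valid sem P c Q \<longleftrightarrow> (\<forall>s1 s2. s1 \<in> P \<longrightarrow> (s1, s2) \<in> sem c \<longrightarrow> s2 \<in> Q)"

text \<open>
  Derivations whose leaves are triples of \<open>H\<close> and whose only rules are consequence and
  ExIntro. A rule of an inductive predicate cannot quantify over the index type of a family
  \<open>P(a)\<close>, so ExIntro takes the set of members of the family; the lemma below recovers the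
  indexed form for every index type.
\<close>

inductive hoare_deriv :: "('s set \<times> 'p \<times> 's set) set \<Rightarrow> 's set \<Rightarrow> 'p \<Rightarrow> 's set \<Rightarrow> bool"
  for H :: "('s set \<times> 'p \<times> 's set) set" where
  premise: "(P, c, Q) \<in> H \<Longrightarrow> hoare_deriv H P c Q"
| consequence: "P \<subseteq> P' \<Longrightarrow> hoare_deriv H P' c Q' \<Longrightarrow> Q' \<subseteq> Q \<Longrightarrow> hoare_deriv H P c Q"
| ex_intro: "(\<And>P. P \<in> F \<Longrightarrow> hoare_deriv H P c Q) \<Longrightarrow> hoare_deriv H (\<Union>F) c Q"

lemma hoare_deriv_ex_intro_indexed:
  assumes "\<And>a. hoare_deriv H (P a) c Q"
  shows "hoare_deriv H {s. \<exists>a. s \<in> P a} c Q"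
proof -
  have "hoare_deriv H (\<Union>(range P)) c Q"
    using assms by (intro hoare_deriv.ex_intro) auto
  moreover have "\<Union>(range P) = {s. \<exists>a. s \<in> P a}"
    by auto
  ultimately show ?thesis
    by simp
qed

type_synonym ('l, 'h, 'ph) rassn = "('l \<times> 'h \<times> 'ph) set"

definition lift_assn :: "('l \<times> 'h) set \<Rightarrow> ('l, 'h, 'ph) rassn" where
  "lift_assn PP = {(sL, sH, c). (sL, sH) \<in> PP}"

definition prog_assn :: "'ph \<Rightarrow> ('l, 'h, 'ph) rassn" where
  "prog_assn c0 = {(sL, sH, c). c = c0}"

definition config_refines :: "('p, 's) semantics \<Rightarrow> 's \<times> 'p \<Rightarrow> 's \<times> 'p \<Rightarrow> bool" where
  "config_refines sem = (\<lambda>(s1, c1) (s2, c2). \<forall>s3. (s2, s3) \<in> sem c2 \<longrightarrow> (s1, s3) \<in> sem c1)"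

definition rel_valid ::
  "('pl, 'l) semantics \<Rightarrow> ('ph, 'h) semantics \<Rightarrow>
    ('l, 'h, 'ph) rassn \<Rightarrow> 'pl \<Rightarrow> ('l, 'h, 'ph) rassn \<Rightarrow> bool" where
  "rel_valid semL semH P cL Q \<longleftrightarrow>
    (\<forall>sL1 sH1 cH1 sL2. (sL1, sH1, cH1) \<in> P \<longrightarrow> (sL1, sL2) \<in> semL cL \<longrightarrow>
      (\<exists>sH2 cH2. config_refines semH (sH1, cH1) (sH2, cH2) \<and> (sL2, sH2, cH2) \<in> Q))"

definition wlp :: "('p, 's) semantics \<Rightarrow> 'p \<Rightarrow> 's set \<Rightarrow> 's set" where
  "wlp sem c X = {s. \<forall>s0. (s, s0) \<in> sem c \<longrightarrow> s0 \<in> X}"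

definition enc :: "('ph, 'h) semantics \<Rightarrow> 'h set \<Rightarrow> ('l, 'h, 'ph) rassn \<Rightarrow> 'l set" where
  "enc semH X P = {sL. \<exists>sH cH. (sL, sH, cH) \<in> P \<and> sH \<in> wlp semH cH X}"

text \<open>
  The linking \<open>\<circ>\<close> of two binary assertions is relational composition \<^term>\<open>(O)\<close>.
\<close>

definition link :: "('l \<times> 'h) set \<Rightarrow> 'h set \<Rightarrow> 'l set"  (infixr "\<odot>" 75) where
  "PP \<odot> PH = {sL. \<exists>sH. (sL, sH) \<in> PP \<and> sH \<in> PH}"

end

theory Submission
  imports Defs
begin

text \<open>
  The encodings of the assertions in the rules are linkings: \<open>P \<and> [c]\<close> becomes
  \<open>P \<odot> wlp(c, X)\<close> and \<open>Q \<and> [skip]\<close> becomes \<open>Q \<odot> X\<close>. Hence Enc-VC-FC is the consequence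
  rule applied to the premise at \<open>X = Q\<^sup>H\<close>, as \<open>P\<^sup>H \<subseteq> wlp(c\<^sup>H, Q\<^sup>H)\<close>. Since linking is
  associative, Enc-VC-Refine at \<open>X\<close> is the instance of Enc-VC-FC whose high-level triple is
  the second premise at \<open>X\<close>. The relational rules follow from the encoding theorem.
\<close>

lemma hoare_valid_iff_wlp: "hoare_valid sem P c Q \<longleftrightarrow> P \<subseteq> wlp sem c Q"
  by (auto simp: hoare_valid_def wlp_def)

lemma wlp_skip:
  assumes "sem c = Id"
  shows "wlp sem c X = X"
  using assms by (auto simp: wlp_def)

text \<open>\<open>prog_assn c\<close> pins the existential program inside \<open>enc\<close> to
  \<open>c\<close>, so only the high-level state stays quantified, as in a linking.\<close>

lemma enc_lift_prog: "enc sem X (lift_assn P \<inter> prog_assn c) = P \<odot> wlp sem c X"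
  by (auto simp: enc_def lift_assn_def prog_assn_def link_def)

lemma link_mono: "A \<subseteq> B \<Longrightarrow> P \<odot> A \<subseteq> P \<odot> B"
  by (auto simp: link_def)

lemma link_relcomp: "(P O Q) \<odot> A = P \<odot> Q \<odot> A"
  by (auto simp: link_def)

text \<open>Turns a derivation into validity once its leaves are valid, since consequence and
  ExIntro both preserve validity.\<close>

lemma hoare_deriv_sound:
  assumes "hoare_deriv H P c Q"
    and "\<And>P c Q. (P, c, Q) \<in> H \<Longrightarrow> hoare_valid sem P c Q"
  shows "hoare_valid sem P c Q"
  using assms(1)
proof induction
  case (premise P c Q)
  then show ?case by (rule assms(2))
next
  case (consequence P P' c Q' Q)
  then show ?case unfolding hoare_valid_def by blast
next
  case (ex_intro F c Q)
  then show ?case unfolding hoare_valid_def by blast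
qed

text \<open>Forwards, every outcome of the refining configuration is an outcome of the initial one,
  so the wlp of any \<open>X\<close> carries over. Backwards, one well-chosen \<open>X\<close> per
  initial configuration suffices.\<close>

lemma rel_valid_iff_enc:
  "rel_valid semL semH P c Q \<longleftrightarrow> (\<forall>X. hoare_valid semL (enc semH X P) c (enc semH X Q))"
proof
  assume valid: "rel_valid semL semH P c Q"
  show "\<forall>X. hoare_valid semL (enc semH X P) c (enc semH X Q)"
    unfolding hoare_valid_def
  proof (intro allI impI)
    fix X s1 s2
    assume "s1 \<in> enc semH X P" and step: "(s1, s2) \<in> semL c"
    then obtain t1 d1 where "(s1, t1, d1) \<in> P" and wlp: "t1 \<in> wlp semH d1 X"
      by (auto simp: enc_def)
    with valid step obtain t2 d2
      where "config_refines semH (t1, d1) (t2, d2)" and "(s2, t2, d2) \<in> Q"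
      unfolding rel_valid_def by blast
    with wlp show "s2 \<in> enc semH X Q"
      by (auto simp: enc_def wlp_def config_refines_def)
  qed
next
  assume valid: "\<forall>X. hoare_valid semL (enc semH X P) c (enc semH X Q)"
  show "rel_valid semL semH P c Q"
    unfolding rel_valid_def
  proof (intro allI impI)
    fix s1 t1 d1 s2
    assume pre: "(s1, t1, d1) \<in> P" and step: "(s1, s2) \<in> semL c"
    \<comment> \<open>For this \<open>X\<close>, a configuration satisfies the wlp iff \<open>(t1, d1)\<close> refines to it.\<close>
    let ?X = "{t3. (t1, t3) \<in> semH d1}"
    have "s1 \<in> enc semH ?X P"
      using pre by (auto simp: enc_def wlp_def)
    with valid step have "s2 \<in> enc semH ?X Q"
      unfolding hoare_valid_def by blast
    then show "\<exists>t2 d2. config_refines semH (t1, d1) (t2, d2) \<and> (s2, t2, d2) \<in> Q"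
      by (auto simp: enc_def wlp_def config_refines_def)
  qed
qed

text \<open>The high-level triple is a hypothesis and not a leaf: it only justifies the inclusion of
  preconditions in the consequence rule.\<close>

lemma enc_vc_fc_deriv:
  assumes skip: "semH skip = Id"
    and high: "hoare_valid semH PH cH QH"
  shows "hoare_deriv
    {(enc semH X (lift_assn P \<inter> prog_assn cH), cL,
      enc semH X (lift_assn Q \<inter> prog_assn skip)) | X. True}
    (P \<odot> PH) cL (Q \<odot> QH)"
proof (rule hoare_deriv.consequence)
  show "P \<odot> PH \<subseteq> enc semH QH (lift_assn P \<inter> prog_assn cH)"
    using high by (simp add: enc_lift_prog link_mono hoare_valid_iff_wlp)
  show "enc semH QH (lift_assn Q \<inter> prog_assn skip) \<subseteq> Q \<odot> QH"
    by (simp add: enc_lift_prog wlp_skip[of semH, OF skip])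
qed (auto intro: hoare_deriv.premise)

lemma enc_vc_fc:
  assumes skip: "semH skip = Id"
    and low: "\<forall>X. hoare_valid semL (enc semH X (lift_assn P \<inter> prog_assn cH)) cL
      (enc semH X (lift_assn Q \<inter> prog_assn skip))"
    and high: "hoare_valid semH PH cH QH"
  shows "hoare_valid semL (P \<odot> PH) cL (Q \<odot> QH)"
  by (rule hoare_deriv_sound[OF enc_vc_fc_deriv[of semH, OF skip high]]) (use low in auto)

lemma enc_vc_refine_deriv:
  assumes skip2: "sem2 skip2 = Id"
    and high: "\<forall>X. hoare_valid sem2 (enc sem3 X (lift_assn P2 \<inter> prog_assn c3)) c2
      (enc sem3 X (lift_assn Q2 \<inter> prog_assn skip3))"
  shows "hoare_deriv
    {(enc sem2 X1 (lift_assn P1 \<inter> prog_assn c2), c1,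
      enc sem2 X1 (lift_assn Q1 \<inter> prog_assn skip2)) | X1. True}
    (enc sem3 X (lift_assn (P1 O P2) \<inter> prog_assn c3)) c1
    (enc sem3 X (lift_assn (Q1 O Q2) \<inter> prog_assn skip3))"
  \<comment> \<open>Unfolding brings fact and goal to the same form, with precondition
    \<open>P1 \<odot> P2 \<odot> wlp sem3 c3 X\<close> and postcondition
    \<open>Q1 \<odot> Q2 \<odot> wlp sem3 skip3 X\<close>.\<close>
  using enc_vc_fc_deriv[of sem2, OF skip2 high[rule_format, of X]]
  unfolding enc_lift_prog link_relcomp .

lemma enc_vc_refine:
  assumes skip2: "sem2 skip2 = Id"
    and low: "\<forall>X. hoare_valid sem1 (enc sem2 X (lift_assn P1 \<inter> prog_assn c2)) c1
      (enc sem2 X (lift_assn Q1 \<inter> prog_assn skip2))"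
    and high: "\<forall>X. hoare_valid sem2 (enc sem3 X (lift_assn P2 \<inter> prog_assn c3)) c2
      (enc sem3 X (lift_assn Q2 \<inter> prog_assn skip3))"
  shows "hoare_valid sem1 (enc sem3 X (lift_assn (P1 O P2) \<inter> prog_assn c3)) c1
    (enc sem3 X (lift_assn (Q1 O Q2) \<inter> prog_assn skip3))"
  by (rule hoare_deriv_sound[OF enc_vc_refine_deriv[of sem2, OF skip2 high]])
    (use low in auto)

theorem corollary21:
  fixes semL :: "('pl, 'l) semantics" and semH :: "('ph, 'h) semantics"
    and skipH :: 'ph
    and cL :: 'pl and cH :: 'ph
    and PP QQ :: "('l \<times> 'h) set" and PH QH :: "'h set"
  fixes sem1 :: "('p1, 's1) semantics" and sem2 :: "('p2, 's2) semantics"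
    and sem3 :: "('p3, 's3) semantics"
    and skip2 :: 'p2 and skip3 :: 'p3
    and c1 :: 'p1 and c2 :: 'p2 and c3 :: 'p3
    and P1 Q1 :: "('s1 \<times> 's2) set" and P2 Q2 :: "('s2 \<times> 's3) set"
  assumes skipH: "semH skipH = Id"
    and skip2: "sem2 skip2 = Id"
    and skip3: "sem3 skip3 = Id"
  shows
    \<comment> \<open>VC-FC\<close>
    "(rel_valid semL semH (lift_assn PP \<inter> prog_assn cH) cL (lift_assn QQ \<inter> prog_assn skipH) \<longrightarrow>
      hoare_valid semH PH cH QH \<longrightarrow>
      hoare_valid semL (PP \<odot> PH) cL (QQ \<odot> QH))
     \<and>
     \<comment> \<open>VC-Refine\<close>
     (rel_valid sem1 sem2 (lift_assn P1 \<inter> prog_assn c2) c1 (lift_assn Q1 \<inter> prog_assn skip2) \<longrightarrow>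
      rel_valid sem2 sem3 (lift_assn P2 \<inter> prog_assn c3) c2 (lift_assn Q2 \<inter> prog_assn skip3) \<longrightarrow>
      rel_valid sem1 sem3 (lift_assn (P1 O P2) \<inter> prog_assn c3) c1
        (lift_assn (Q1 O Q2) \<inter> prog_assn skip3))
     \<and>
     \<comment> \<open>Enc-VC-FC\<close>
     ((\<forall>X. hoare_valid semL (enc semH X (lift_assn PP \<inter> prog_assn cH)) cL
             (enc semH X (lift_assn QQ \<inter> prog_assn skipH))) \<longrightarrow>
      hoare_valid semH PH cH QH \<longrightarrow>
      hoare_valid semL (PP \<odot> PH) cL (QQ \<odot> QH))
     \<and>
     \<comment> \<open>Enc-VC-Refine\<close>
     ((\<forall>X1. hoare_valid sem1 (enc sem2 X1 (lift_assn P1 \<inter> prog_assn c2)) c1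
              (enc sem2 X1 (lift_assn Q1 \<inter> prog_assn skip2))) \<longrightarrow>
      (\<forall>X2. hoare_valid sem2 (enc sem3 X2 (lift_assn P2 \<inter> prog_assn c3)) c2
              (enc sem3 X2 (lift_assn Q2 \<inter> prog_assn skip3))) \<longrightarrow>
      (\<forall>X. hoare_valid sem1 (enc sem3 X (lift_assn (P1 O P2) \<inter> prog_assn c3)) c1
             (enc sem3 X (lift_assn (Q1 O Q2) \<inter> prog_assn skip3))))
     \<and>
     \<comment> \<open>Enc-VC-FC, derived by consequence and ExIntro from its premise on \<open>cL\<close>\<close>
     (hoare_valid semH PH cH QH \<longrightarrow>
      hoare_deriv
        {(enc semH X (lift_assn PP \<inter> prog_assn cH), cL,
          enc semH X (lift_assn QQ \<inter> prog_assn skipH)) | X. True}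
        (PP \<odot> PH) cL (QQ \<odot> QH))
     \<and>
     \<comment> \<open>Enc-VC-Refine, derived by consequence and ExIntro from its premise on \<open>c1\<close>\<close>
     ((\<forall>X2. hoare_valid sem2 (enc sem3 X2 (lift_assn P2 \<inter> prog_assn c3)) c2
              (enc sem3 X2 (lift_assn Q2 \<inter> prog_assn skip3))) \<longrightarrow>
      (\<forall>X. hoare_deriv
         {(enc sem2 X1 (lift_assn P1 \<inter> prog_assn c2), c1,
           enc sem2 X1 (lift_assn Q1 \<inter> prog_assn skip2)) | X1. True}
         (enc sem3 X (lift_assn (P1 O P2) \<inter> prog_assn c3)) c1
         (enc sem3 X (lift_assn (Q1 O Q2) \<inter> prog_assn skip3))))"
  \<comment> \<open>This makes the two relational rules literally the two encoded ones.\<close>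
  unfolding rel_valid_iff_enc
  using enc_vc_fc[of semH, OF skipH] enc_vc_refine[of sem2, OF skip2]
    enc_vc_fc_deriv[of semH, OF skipH] enc_vc_refine_deriv[of sem2, OF skip2]
  by (intro conjI impI allI)

end
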